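(* Let $m\ge1$ be an integer, let $n\mapsto \rho_n$ be an $m$-periodic function from $\mathbb Z$ to $[0,1]$, and let $Y\subset\mathbb Z^+=\{1,2,3,\dots\}$ be the random set in which each $n\in\mathbb Z^+$ is, independently of the others, included with probability $\rho_n$. Let $k\ge 1$ and let $\xi_1,\dots,\xi_k\in\mathcal C_R$. Then $$\mathbb E\left[\ \sum_{S\subset Y,\ |S|=k}\tau^{\sigma(S,Y)}\prod_{i=1}^k\xi_i^{-s_i}\right]=\tau^{k(k+1)/2}\;(1\ 0\ \cdots\ 0)\ \mathcal A_1\mathcal A_2\cdots\mathcal A_k\begin{pmatrix}1\\ \vdots\\ 1\end{pmatrix},$$ where $\mathbb E$ is the average over $Y$, $S=\{s_1<s_2<\cdots<s_k\}$, and the quantities $\tau$, $\sigma(S,Y)$, $\mathcal C_R$ and the $m\times m$ matrices $\mathcal A_i$ are as defined in the context.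
   Context: Let $p,q\ge 0$ with $p+q=1$ and $q\neq0$, and $\tau=p/q$. For sets of integers $U,V$, $\sigma(U,V)=\#\{(u,v):u\in U,\ v\in V,\ u\ge v\}$. $\mathcal C_R$ is the circle with center $0$ and radius $R$, where $R$ is assumed so large that $p+q\xi\xi'-\xi\ne0$ for all complex $\xi,\xi'$ with $|\xi|\ge R$, $|\xi'|\ge R$. For $1\le i\le k$ and $n\in\mathbb Z$ let $\varphi(i,n)=1-\rho_n+\rho_n\,\tau^{k-i+1}$. The $m\times m$ matrix $\mathcal A_i$ has entries, with indices $\mu,\nu$ running from $0$ to $m-1$, $$A_{i,\mu,\nu}=\frac{1}{(\xi_i\xi_{i+1}\cdots\xi_k)^m-\prod_{n=1}^m\varphi(i,n)}\times\begin{cases}(\xi_i\cdots\xi_k)^m\,\xi_i^{-\nu}\,\rho_\nu\prod_{n=\mu+1}^{\nu-1}\varphi(i,n) & \text{if }\mu<\nu,\\[4pt] \xi_i^{-\nu}\,\rho_\nu\prod_{n=\mu+1}^{\nu+m-1}\varphi(i,n) & \text{if }\mu\ge\nu,\end{cases}$$ where empty products equal $1$. The right-hand side of the claim contains the sum of the entries of the top row of the matrix product, with lower-index matrices on the left. *)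

theory Defs
  imports "HOL-Probability.Probability" "Jordan_Normal_Form.Matrix"
begin

definition sigma_pairs :: "int set \<Rightarrow> int set \<Rightarrow> nat" where
  "sigma_pairs U V = card {(u, v). u \<in> U \<and> v \<in> V \<and> u \<ge> v}"

text \<open>The \<open>i\<close>-th smallest element of a finite set, counting from \<open>i = 1\<close>.\<close>
definition nth_elem :: "int set \<Rightarrow> nat \<Rightarrow> int" where
  "nth_elem S i = sorted_list_of_set S ! (i - 1)"

definition phi :: "real \<Rightarrow> (int \<Rightarrow> real) \<Rightarrow> nat \<Rightarrow> nat \<Rightarrow> int \<Rightarrow> real" where
  "phi \<tau> \<rho> k i n = 1 - \<rho> n + \<rho> n * \<tau> ^ (k - i + 1)"

definition A_entry ::
  "real \<Rightarrow> (int \<Rightarrow> real) \<Rightarrow> nat \<Rightarrow> nat \<Rightarrow> (nat \<Rightarrow> complex) \<Rightarrow> nat \<Rightarrow> nat \<Rightarrow> nat \<Rightarrow> complex" where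
  "A_entry \<tau> \<rho> m k \<xi> i \<mu> \<nu> =
     1 / ((\<Prod>j=i..k. \<xi> j) ^ m - of_real (\<Prod>n=1..int m. phi \<tau> \<rho> k i n)) *
     (if \<mu> < \<nu>
      then (\<Prod>j=i..k. \<xi> j) ^ m * \<xi> i powi (- int \<nu>) * of_real (\<rho> (int \<nu>)) *
           of_real (\<Prod>n=int \<mu> + 1..int \<nu> - 1. phi \<tau> \<rho> k i n)
      else \<xi> i powi (- int \<nu>) * of_real (\<rho> (int \<nu>)) *
           of_real (\<Prod>n=int \<mu> + 1..int \<nu> + int m - 1. phi \<tau> \<rho> k i n))"

definition A_mat ::
  "real \<Rightarrow> (int \<Rightarrow> real) \<Rightarrow> nat \<Rightarrow> nat \<Rightarrow> (nat \<Rightarrow> complex) \<Rightarrow> nat \<Rightarrow> complex Matrix.mat" where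
  "A_mat \<tau> \<rho> m k \<xi> i = Matrix.mat m m (\<lambda>(\<mu>, \<nu>). A_entry \<tau> \<rho> m k \<xi> i \<mu> \<nu>)"

text \<open>The product \<open>B 1 * B 2 * \<dots> * B k\<close> of \<open>m \<times> m\<close> matrices, lower indices on the left.\<close>
definition mat_prod :: "nat \<Rightarrow> nat \<Rightarrow> (nat \<Rightarrow> complex Matrix.mat) \<Rightarrow> complex Matrix.mat" where
  "mat_prod m k B = foldr (*) (map B [1..<k + 1]) (1\<^sub>m m)"

definition subset_term ::
  "real \<Rightarrow> nat \<Rightarrow> (nat \<Rightarrow> complex) \<Rightarrow> int set \<Rightarrow> int set \<Rightarrow> complex" where
  "subset_term \<tau> k \<xi> Y S =
     of_real (\<tau> ^ sigma_pairs S Y) * (\<Prod>i=1..k. \<xi> i powi (- nth_elem S i))"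

end

theory Submission
  imports Defs
begin

text \<open>
  For \<open>S = {s\<^sub>1 < \<dots> < s\<^sub>k} \<subseteq> Y\<close> every \<open>y \<in> Y\<close> in \<open>(s\<^bsub>i-1\<^esub>, s\<^sub>i]\<close> (with \<open>s\<^sub>0 = 0\<close>) is counted \<open>k - i + 1\<close> times
  in \<open>\<sigma>(S, Y)\<close>, so the summand is a product over the sites \<open>1, \<dots>, s\<^sub>k\<close> of factors that depend on a
  single membership \<open>n \<in> Y\<close> only. By independence its expectation is the product of the expected
  factors. As \<open>R > max 1 \<tau>\<close>, all sums are dominated by \<open>\<Sum>\<^sub>S \<Prod>\<^bsub>s\<in>S\<^esub> (max 1 \<tau> / R)\<^sup>s\<close> over finite sets,
  and dominated convergence exchanges the sum with the expectation.

  Let \<open>T\<^sub>j(s)\<close> be the resulting sum over \<open>j\<close>-subsets of \<open>{s+1, s+2, \<dots>}\<close>. Distinguishing whether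
  \<open>s + 1\<close> is chosen expresses \<open>T\<^bsub>j+1\<^esub>(s)\<close> through \<open>T\<^sub>j(s+1)\<close> and \<open>T\<^bsub>j+1\<^esub>(s+1)\<close>. After one
  period of \<open>m\<close> such steps, \<open>T\<^bsub>j+1\<^esub>(s+m)\<close> is a known multiple of \<open>T\<^bsub>j+1\<^esub>(s)\<close>; solving for
  \<open>T\<^bsub>j+1\<^esub>(s)\<close> gives exactly the matrix \<open>\<A>\<^bsub>k-j\<^esub>\<close> acting on \<open>(T\<^sub>j(0), \<dots>, T\<^sub>j(m-1))\<close>.
\<close>

section \<open>Ranks from above and product weights\<close>

text \<open>Points are indexed by their rank from above, so the rank \<open>c\<close> is \<open>k - i + 1\<close> in the notation of
  the theorem; a function \<open>a c n\<close> is the weight of a chosen site, \<open>b c n\<close> that of an unchosen one.\<close>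

definition rank_above :: "int set \<Rightarrow> int \<Rightarrow> nat" where
  "rank_above S n = card {x \<in> S. n \<le> x}"

text \<open>For nonempty \<open>S\<close> this is the integer interval from \<open>s + 1\<close> to
  the maximum of \<open>S\<close>; the existential form makes it empty for empty
  \<open>S\<close>.\<close>

definition sites :: "int \<Rightarrow> int set \<Rightarrow> int set" where
  "sites s S = {n. s < n \<and> (\<exists>x\<in>S. n \<le> x)}"

definition ksets :: "int \<Rightarrow> nat \<Rightarrow> int set set" where
  "ksets s j = {S. S \<subseteq> {s<..} \<and> finite S \<and> card S = j}"

definition wt :: "(nat \<Rightarrow> int \<Rightarrow> complex) \<Rightarrow> (nat \<Rightarrow> int \<Rightarrow> complex) \<Rightarrow> int \<Rightarrow> int set \<Rightarrow> complex" where
  "wt a b s S = (\<Prod>n\<in>sites s S. (if n \<in> S then a else b) (rank_above S n) n)"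

definition wt_sum :: "(nat \<Rightarrow> int \<Rightarrow> complex) \<Rightarrow> (nat \<Rightarrow> int \<Rightarrow> complex) \<Rightarrow> nat \<Rightarrow> int \<Rightarrow> complex" where
  "wt_sum a b j s = (\<Sum>\<^sub>\<infinity>S\<in>ksets s j. wt a b s S)"

lemma finite_sites: "finite S \<Longrightarrow> finite (sites s S)"
proof -
  assume "finite S"
  then have "finite (\<Union>x\<in>S. {s<..x})" by simp
  moreover have "sites s S = (\<Union>x\<in>S. {s<..x})"
    unfolding sites_def by auto
  ultimately show ?thesis by simp
qed

lemma subset_sites: "S \<subseteq> {s<..} \<Longrightarrow> S \<subseteq> sites s S"
  unfolding sites_def by auto

text \<open>Moving up inside \<open>S\<close> strictly lowers the rank, so ranks are distinct; being
  \<open>card S\<close> values in \<open>{1..card S}\<close>, they exhaust it.\<close>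

lemma bij_betw_rank_above:
  assumes "finite S"
  shows "bij_betw (rank_above S) S {1..card S}"
proof -
  have "strict_antimono_on S (rank_above S)"
  proof (rule monotone_onI)
    fix x y assume "x \<in> S" "y \<in> S" "x < y"
    then have "{z \<in> S. y \<le> z} \<subseteq> {z \<in> S. x \<le> z} - {x}" "x \<in> {z \<in> S. x \<le> z}" by auto
    then have "{z \<in> S. y \<le> z} \<subset> {z \<in> S. x \<le> z}" by blast
    then show "rank_above S x > rank_above S y"
      unfolding rank_above_def using assms by (intro psubset_card_mono) auto
  qed
  then have inj: "inj_on (rank_above S) S"
    unfolding monotone_on_def inj_on_def by (metis less_irrefl linorder_neqE)
  have "rank_above S ` S \<subseteq> {1..card S}"
  proof
    fix c assume "c \<in> rank_above S ` S"
    then obtain x where x: "x \<in> S" "c = rank_above S x" by auto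
    have "c \<le> card S" unfolding x rank_above_def using assms by (intro card_mono) auto
    moreover have "c \<noteq> 0" unfolding x rank_above_def using assms x(1) by auto
    ultimately show "c \<in> {1..card S}" by auto
  qed
  then have "rank_above S ` S = {1..card S}"
    by (intro card_subset_eq) (simp_all add: card_image[OF inj])
  with inj show ?thesis by (simp add: bij_betw_def)
qed

lemma prod_rank_above:
  fixes f :: "nat \<Rightarrow> 'c::comm_monoid_mult"
  assumes "finite S"
  shows "(\<Prod>n\<in>S. f (rank_above S n)) = (\<Prod>c=1..card S. f c)"
  using prod.reindex_bij_betw[OF bij_betw_rank_above[OF assms]] .

text \<open>Each rank from 1 to \<open>j\<close> belongs to exactly one chosen point, so a factor
  depending on the rank alone contributes the same product for every \<open>S\<close>. This later
  extracts the powers of \<open>\<tau>\<close> and the factors produced by a shift.\<close>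

lemma wt_mult_chosen:
  assumes "S \<in> ksets s j"
  shows "wt (\<lambda>c n. d c * a c n) b s S = (\<Prod>c=1..j. d c) * wt a b s S"
proof -
  have S: "finite S" "card S = j" "S \<subseteq> sites s S"
    using assms subset_sites by (auto simp: ksets_def)
  have "wt (\<lambda>c n. d c * a c n) b s S =
     (\<Prod>n\<in>sites s S. (if n \<in> S then d (rank_above S n) else 1) * (if n \<in> S then a else b) (rank_above S n) n)"
    unfolding wt_def by (intro prod.cong) auto
  also have "\<dots> = (\<Prod>n\<in>sites s S. if n \<in> S then d (rank_above S n) else 1) * wt a b s S"
    unfolding wt_def by (simp add: prod.distrib)
  also have "(\<Prod>n\<in>sites s S. if n \<in> S then d (rank_above S n) else 1) = (\<Prod>n\<in>S. d (rank_above S n))"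
    using S finite_sites[OF S(1)] by (subst prod.mono_neutral_cong_right[of "sites s S" S]) auto
  finally show ?thesis unfolding prod_rank_above[OF S(1)] S(2) .
qed

text \<open>Translation preserves order and hence ranks; only the site argument of the weights
  moves.\<close>

lemma wt_shift:
  "wt a b (s + t) ((\<lambda>x. x + t) ` S) = wt (\<lambda>c n. a c (n + t)) (\<lambda>c n. b c (n + t)) s S"
proof -
  have sites: "sites (s + t) ((\<lambda>x. x + t) ` S) = (\<lambda>x. x + t) ` sites s S"
  proof (intro Set.set_eqI iffI)
    fix n assume "n \<in> sites (s + t) ((\<lambda>x. x + t) ` S)"
    then have "n - t \<in> sites s S" by (auto simp: sites_def intro: rev_bexI)
    then show "n \<in> (\<lambda>x. x + t) ` sites s S" by (metis add.commute diff_add_cancel image_eqI)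
  qed (auto simp: sites_def)
  have rank: "rank_above ((\<lambda>x. x + t) ` S) (n + t) = rank_above S n" for n
  proof -
    have "{x \<in> (\<lambda>x. x + t) ` S. n + t \<le> x} = (\<lambda>x. x + t) ` {x \<in> S. n \<le> x}" by auto
    then show ?thesis unfolding rank_above_def by (simp add: card_image)
  qed
  show ?thesis unfolding wt_def sites
    by (subst prod.reindex) (auto simp: rank image_iff intro!: prod.cong)
qed

text \<open>The site \<open>s + 1\<close> lies below all points of \<open>S\<close>, so it has rank
  \<open>Suc j\<close>; it counts as a site because \<open>S\<close> is nonempty.\<close>

lemma wt_skip:
  assumes "S \<in> ksets (s + 1) (Suc j)"
  shows "wt a b s S = b (Suc j) (s + 1) * wt a b (s + 1) S"
proof -
  have S: "S \<subseteq> {s+1<..}" "finite S" "card S = Suc j" using assms by (auto simp: ksets_def)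
  then obtain x where "x \<in> S" by fastforce
  moreover from this S(1) have "s + 1 \<le> x" by auto
  ultimately have "sites s S = insert (s + 1) (sites (s + 1) S)"
    unfolding sites_def by (auto intro: bexI[of _ x])
  moreover have "s + 1 \<notin> sites (s + 1) S" "s + 1 \<notin> S" using S by (auto simp: sites_def)
  moreover have "{x \<in> S. s + 1 \<le> x} = S" using S by auto
  then have "rank_above S (s + 1) = Suc j" unfolding rank_above_def using S by simp
  ultimately show ?thesis unfolding wt_def using finite_sites[OF S(2)] by simp
qed

text \<open>A new least point takes rank \<open>Suc j\<close> and leaves all ranks above it
  unchanged.\<close>

lemma wt_insert:
  assumes "S \<in> ksets (s + 1) j"
  shows "wt a b s (insert (s + 1) S) = a (Suc j) (s + 1) * wt a b (s + 1) S"
proof -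
  have S: "S \<subseteq> {s+1<..}" "finite S" "card S = j" using assms by (auto simp: ksets_def)
  have sites: "sites s (insert (s + 1) S) = insert (s + 1) (sites (s + 1) S)"
    using S(1) unfolding sites_def by (auto simp: subset_iff dest: zless_imp_add1_zle)
  have notin: "s + 1 \<notin> sites (s + 1) S" "s + 1 \<notin> S" using S by (auto simp: sites_def)
  have "{x \<in> insert (s + 1) S. s + 1 \<le> x} = insert (s + 1) S" using S by auto
  then have r0: "rank_above (insert (s + 1) S) (s + 1) = Suc j"
    unfolding rank_above_def using S notin by simp
  have r1: "rank_above (insert (s + 1) S) n = rank_above S n" if "n \<in> sites (s + 1) S" for n
    unfolding rank_above_def using that by (intro arg_cong[where f = card]) (auto simp: sites_def)
  have "(\<Prod>n\<in>sites (s + 1) S. (if n \<in> insert (s + 1) S then a else b) (rank_above (insert (s + 1) S) n) n)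
     = wt a b (s + 1) S"
    unfolding wt_def using notin by (intro prod.cong) (auto simp: r1)
  then show ?thesis using notin finite_sites[OF S(2)] r0 unfolding wt_def[of a b s] sites by simp
qed

section \<open>Domination by geometric products and absolute summability\<close>

text \<open>Double counting of the pairs \<open>(n, x)\<close> with \<open>s < n \<le> x\<close> and
  \<open>x \<in> S\<close>: grouping by \<open>n\<close> gives the ranks, grouping by
  \<open>x\<close> gives the distances from \<open>s\<close>.\<close>

lemma prod_rank_above_sites:
  fixes B :: real
  assumes "finite S"
  shows "(\<Prod>n\<in>sites s S. B ^ rank_above S n) = (\<Prod>x\<in>S. B ^ nat (x - s))"
proof -
  have "(\<Prod>n\<in>sites s S. B ^ rank_above S n) = (\<Prod>n\<in>sites s S. \<Prod>x\<in>{x. x \<in> S \<and> n \<le> x}. B)"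
    unfolding rank_above_def by simp
  also have "\<dots> = (\<Prod>x\<in>S. \<Prod>n\<in>{n. n \<in> sites s S \<and> n \<le> x}. B)"
    by (rule prod.swap_restrict[OF finite_sites[OF assms] assms])
  also have "\<dots> = (\<Prod>x\<in>S. B ^ nat (x - s))"
  proof (rule prod.cong[OF refl])
    fix x assume "x \<in> S"
    then have "{n. n \<in> sites s S \<and> n \<le> x} = {s<..x}" by (auto simp: sites_def)
    then show "(\<Prod>n\<in>{n. n \<in> sites s S \<and> n \<le> x}. B) = B ^ nat (x - s)" by simp
  qed
  finally show ?thesis .
qed

text \<open>The bounds \<open>B ^ c\<close> at the sites are redistributed by double counting onto
  the points of \<open>S\<close>, which leaves a product over \<open>S\<close> alone with ratio
  \<open>B * r\<close>.\<close>

lemma norm_wt_le: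
  assumes S: "S \<in> ksets s j" and s: "0 \<le> s" and B: "1 \<le> B" and r: "0 \<le> r"
    and a: "\<And>c n. n \<in> S \<Longrightarrow> norm (a c n) \<le> B ^ c * r ^ nat n"
    and b: "\<And>c n. norm (b c n) \<le> B ^ c"
  shows "norm (wt a b s S) \<le> (\<Prod>x\<in>S. (B * r) ^ nat x)"
proof -
  have S': "finite S" "card S = j" "S \<subseteq> sites s S"
    using assms subset_sites by (auto simp: ksets_def)
  have "norm (wt a b s S) = (\<Prod>n\<in>sites s S. norm ((if n \<in> S then a else b) (rank_above S n) n))"
    unfolding wt_def by (simp add: prod_norm)
  also have "\<dots> \<le> (\<Prod>n\<in>sites s S. B ^ rank_above S n * (if n \<in> S then r ^ nat n else 1))"
    using a b by (intro prod_mono) auto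
  also have "\<dots> = (\<Prod>x\<in>S. B ^ nat (x - s)) * (\<Prod>n\<in>sites s S. if n \<in> S then r ^ nat n else 1)"
    by (simp add: prod.distrib prod_rank_above_sites[OF S'(1)])
  also have "(\<Prod>n\<in>sites s S. if n \<in> S then r ^ nat n else 1) = (\<Prod>n\<in>S. r ^ nat n)"
    using S' finite_sites[OF S'(1)] by (subst prod.mono_neutral_cong_right[of "sites s S" S]) auto
  \<comment> \<open>Since \<open>0 \<le> s\<close> and \<open>1 \<le> B\<close>, the exponent
    \<open>x - s\<close> may be enlarged to \<open>x\<close>.\<close>
  also have "(\<Prod>x\<in>S. B ^ nat (x - s)) * (\<Prod>n\<in>S. r ^ nat n) \<le> (\<Prod>x\<in>S. (B * r) ^ nat x)"
    unfolding prod.distrib[symmetric] power_mult_distrib using s B r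
    by (intro prod_mono conjI mult_nonneg_nonneg mult_right_mono power_increasing) auto
  finally show ?thesis .
qed

text \<open>Enlarging \<open>F\<close> to all subsets of its union turns the sum into the product of
  the factors \<open>1 + r ^ nat x\<close>; then \<open>1 + y \<le> exp y\<close> and the geometric
  series give a bound uniform in \<open>F\<close>.\<close>

lemma sum_prod_power_le:
  fixes r :: real
  assumes r: "0 \<le> r" "r < 1" and F: "finite F" "\<And>S. S \<in> F \<Longrightarrow> finite S \<and> S \<subseteq> {0<..}"
  shows "(\<Sum>S\<in>F. \<Prod>x\<in>S. r ^ nat x) \<le> exp (1 / (1 - r))"
proof -
  define U where "U = \<Union>F"
  have U: "finite U" "U \<subseteq> {0<..}" unfolding U_def using F by auto
  have "(\<Sum>S\<in>F. \<Prod>x\<in>S. r ^ nat x) \<le> (\<Sum>S\<in>Pow U. \<Prod>x\<in>S. r ^ nat x)"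
    using F U r by (intro sum_mono2 prod_nonneg) (auto simp: U_def)
  also have "\<dots> = (\<Prod>x\<in>U. r ^ nat x + 1)"
    using prod_add[OF U(1), of "\<lambda>x. r ^ nat x" "\<lambda>_. 1"] by simp
  also have "\<dots> \<le> (\<Prod>x\<in>U. exp (r ^ nat x))"
    using r by (intro prod_mono) (auto simp: add.commute[of _ 1] intro: add_nonneg_nonneg)
  also have "\<dots> = exp (\<Sum>x\<in>U. r ^ nat x)" using U(1) by (simp add: exp_sum)
  also have "(\<Sum>x\<in>U. r ^ nat x) = (\<Sum>n\<in>nat ` U. r ^ n)"
    using U(2) by (subst sum.reindex) (auto simp: inj_on_def subset_iff)
  also have "\<dots> \<le> (\<Sum>n. r ^ n)"
    using U(1) r by (intro sum_le_suminf) auto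
  also have "\<dots> = 1 / (1 - r)" using r by (intro suminf_geometric) auto
  finally show ?thesis by simp
qed

lemma summable_prod_power:
  fixes r :: real
  assumes "0 \<le> r" "r < 1" "0 \<le> s"
  shows "(\<lambda>S. \<Prod>x\<in>S. r ^ nat x) summable_on ksets s j"
proof (rule nonneg_bdd_above_summable_on)
  have "finite S \<and> S \<subseteq> {0<..}" if "S \<in> ksets s j" for S
    using that \<open>0 \<le> s\<close> by (fastforce simp: ksets_def)
  then show "bdd_above (sum (\<lambda>S. \<Prod>x\<in>S. r ^ nat x) ` {F. F \<subseteq> ksets s j \<and> finite F})"
    using assms by (intro bdd_aboveI2[where M = "exp (1 / (1 - r))"] sum_prod_power_le) auto
qed (use assms in \<open>auto intro: prod_nonneg\<close>)

lemma abs_summable_wt: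
  assumes s: "0 \<le> s" and B: "1 \<le> B" and r: "0 \<le> r" "B * r < 1"
    and a: "\<And>c n. 0 < n \<Longrightarrow> norm (a c n) \<le> B ^ c * r ^ nat n"
    and b: "\<And>c n. norm (b c n) \<le> B ^ c"
  shows "(\<lambda>S. norm (wt a b s S)) summable_on ksets s j"
proof (rule summable_on_comparison_test)
  show "(\<lambda>S. \<Prod>x\<in>S. (B * r) ^ nat x) summable_on ksets s j"
    using assms by (intro summable_prod_power) auto
  show "norm (wt a b s S) \<le> (\<Prod>x\<in>S. (B * r) ^ nat x)" if "S \<in> ksets s j" for S
    using that s B r b by (intro norm_wt_le a) (auto simp: ksets_def)
qed auto

section \<open>Recursion, unrolling and translation of the sums\<close>

lemma ksets_Suc:
  "ksets s (Suc j) = insert (s + 1) ` ksets (s + 1) j \<union> ksets (s + 1) (Suc j)"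
proof -
  have gt: "s + 1 < x" if "S \<subseteq> {s<..}" "x \<in> S" "x \<noteq> s + 1" for S x
    using that by fastforce
  have "S \<in> insert (s + 1) ` ksets (s + 1) j \<union> ksets (s + 1) (Suc j)" if "S \<in> ksets s (Suc j)" for S
  proof (cases "s + 1 \<in> S")
    case True
    then have "S = insert (s + 1) (S - {s + 1})" by auto
    moreover have "S - {s + 1} \<in> ksets (s + 1) j"
      using that True gt by (auto simp: ksets_def)
    ultimately show ?thesis by blast
  next
    case False
    then have "S \<in> ksets (s + 1) (Suc j)"
      using that gt[of S] by (auto simp: ksets_def)
    then show ?thesis by blast
  qed
  moreover have "insert (s + 1) S \<in> ksets s (Suc j)" if "S \<in> ksets (s + 1) j" for S
  proof -
    have "s + 1 \<notin> S" using that by (auto simp: ksets_def)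
    then show ?thesis using that by (fastforce simp: ksets_def)
  qed
  moreover have "ksets (s + 1) (Suc j) \<subseteq> ksets s (Suc j)"
    by (fastforce simp: ksets_def)
  ultimately show ?thesis by blast
qed

lemma wt_sum_0: "wt_sum a b 0 s = 1"
proof -
  have "ksets s 0 = {{}}" by (auto simp: ksets_def)
  then show ?thesis by (simp add: wt_sum_def wt_def sites_def)
qed

text \<open>The sets containing \<open>s + 1\<close> and those avoiding it form disjoint families.
  Removing \<open>s + 1\<close> reindexes the first one, and each family releases one factor of rank
  \<open>Suc j\<close>.\<close>

lemma wt_sum_Suc:
  assumes "\<And>j. (\<lambda>S. wt a b (s + 1) S) summable_on ksets (s + 1) j"
  shows "wt_sum a b (Suc j) s =
    a (Suc j) (s + 1) * wt_sum a b j (s + 1) + b (Suc j) (s + 1) * wt_sum a b (Suc j) (s + 1)"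
proof -
  have inj: "inj_on (insert (s + 1)) (ksets (s + 1) j)"
    by (rule inj_on_inverseI[where g = "\<lambda>S. S - {s + 1}"]) (auto simp: ksets_def)
  have 1: "((\<lambda>S. wt a b s S) has_sum a (Suc j) (s + 1) * wt_sum a b j (s + 1))
     (insert (s + 1) ` ksets (s + 1) j)"
    unfolding has_sum_reindex[OF inj] o_def wt_sum_def
    using has_sum_cmult_right[OF has_sum_infsum[OF assms[of j]], of "a (Suc j) (s + 1)"]
    by (simp add: wt_insert cong: has_sum_cong)
  have 2: "((\<lambda>S. wt a b s S) has_sum b (Suc j) (s + 1) * wt_sum a b (Suc j) (s + 1))
     (ksets (s + 1) (Suc j))"
    unfolding wt_sum_def
    using has_sum_cmult_right[OF has_sum_infsum[OF assms[of "Suc j"]], of "b (Suc j) (s + 1)"]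
    by (simp add: wt_skip cong: has_sum_cong)
  have "insert (s + 1) ` ksets (s + 1) j \<inter> ksets (s + 1) (Suc j) = {}"
    by (auto simp: ksets_def)
  from infsumI[OF has_sum_Un_disjoint[OF 1 2 this]] show ?thesis
    unfolding wt_sum_def[of a b "Suc j" s] ksets_Suc[of s j] by simp
qed

text \<open>The index \<open>t\<close> is the position of the least chosen point and the product
  before it is the weight of the skipped sites; the last term collects the sets that avoid the first
  \<open>l\<close> sites.\<close>

lemma wt_sum_unroll:
  assumes "\<And>s j. 0 \<le> s \<Longrightarrow> wt a b s summable_on ksets s j" and "0 \<le> s"
  shows "wt_sum a b (Suc j) s =
    (\<Sum>t\<in>{s+1..s + int l}. (\<Prod>n=s+1..t-1. b (Suc j) n) * a (Suc j) t * wt_sum a b j t) +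
    (\<Prod>n=s+1..s + int l. b (Suc j) n) * wt_sum a b (Suc j) (s + int l)"
proof (induction l)
  case (Suc l)
  define u where "u = s + int l"
  have [simp]: "s + int (Suc l) = u + 1" unfolding u_def by auto
  have ins: "{s+1..u+1} = insert (u + 1) {s+1..u}" unfolding u_def by auto
  have notin: "u + 1 \<notin> {s+1..u}" by auto
  have "wt_sum a b (Suc j) u = a (Suc j) (u + 1) * wt_sum a b j (u + 1)
      + b (Suc j) (u + 1) * wt_sum a b (Suc j) (u + 1)"
    using assms by (intro wt_sum_Suc) (auto simp: u_def)
  with Suc.IH show ?case
    unfolding \<open>s + int (Suc l) = u + 1\<close> u_def[symmetric] ins
    by (simp add: notin algebra_simps)
qed simp

lemma wt_sum_mult_chosen:
  "wt_sum (\<lambda>c n. d c * a c n) b j s = (\<Prod>c=1..j. d c) * wt_sum a b j s"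
  unfolding wt_sum_def by (simp add: wt_mult_chosen infsum_cmult_right' cong: infsum_cong)

text \<open>Translation by \<open>t\<close> matches the two index families; unchosen sites keep
  their weights, and the chosen point of each rank \<open>c\<close> gains one factor
  \<open>d c\<close>.\<close>

lemma wt_sum_shift:
  assumes "\<And>c n. a c (n + t) = d c * a c n" and "\<And>c n. b c (n + t) = b c n"
  shows "wt_sum a b j (s + t) = (\<Prod>c=1..j. d c) * wt_sum a b j s"
proof -
  have "ksets (s + t) j = (\<lambda>S. (\<lambda>x. x + t) ` S) ` ksets s j"
  proof (intro Set.set_eqI iffI)
    fix S assume S: "S \<in> ksets (s + t) j"
    have "(\<lambda>x. x - t) ` S \<in> ksets s j"
      using S by (auto simp: ksets_def card_image)
    moreover have "S = (\<lambda>x. x + t) ` ((\<lambda>x. x - t) ` S)" by (simp add: image_image)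
    ultimately show "S \<in> (\<lambda>S. (\<lambda>x. x + t) ` S) ` ksets s j" by blast
  qed (auto simp: ksets_def card_image)
  moreover have "inj (\<lambda>S. (\<lambda>x. x + t) ` S)" by (intro injI) (auto simp: inj_image_eq_iff)
  ultimately have "wt_sum a b j (s + t) = (\<Sum>\<^sub>\<infinity>S\<in>ksets s j. wt a b (s + t) ((\<lambda>x. x + t) ` S))"
    unfolding wt_sum_def by (simp add: infsum_reindex inj_on_subset o_def)
  also have "\<dots> = wt_sum (\<lambda>c n. d c * a c n) b j s"
    unfolding wt_sum_def wt_shift assms ..
  finally show ?thesis by (simp add: wt_sum_mult_chosen)
qed

section \<open>Expectations of products and of infinite sums\<close>

text \<open>Each factor is affine in the indicator of a single event, so independence lets every
  indicator be replaced by its probability.\<close>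

lemma (in prob_space) expectation_prod_indep_events:
  fixes \<alpha> \<beta> :: "'i \<Rightarrow> complex"
  assumes ind: "indep_events A I" and U: "finite U" "U \<subseteq> I"
  shows "integrable M (\<lambda>\<omega>. \<Prod>n\<in>U. \<beta> n * indicator (A n) \<omega> + \<alpha> n)" (is "integrable M ?f")
    and "(\<integral>\<omega>. (\<Prod>n\<in>U. \<beta> n * indicator (A n) \<omega> + \<alpha> n) \<partial>M) = (\<Prod>n\<in>U. \<beta> n * prob (A n) + \<alpha> n)"
proof -
  \<comment> \<open>Restricting to \<open>space M\<close> makes \<open>E {}\<close> the whole space,
    where a plain empty intersection would be \<open>UNIV\<close>.\<close>
  define E where "E V = {\<omega> \<in> space M. \<forall>n\<in>V. \<omega> \<in> A n}" for V
  have E: "E V \<in> events \<and> prob (E V) = (\<Prod>n\<in>V. prob (A n))" if "V \<subseteq> U" for V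
  proof (cases "V = {}")
    case True
    then show ?thesis by (simp add: E_def prob_space)
  next
    case False
    have ev: "A n \<in> events" if "n \<in> V" for n
      using ind U \<open>V \<subseteq> U\<close> that unfolding indep_events_def by auto
    have fin: "finite V" using U that finite_subset by auto
    have "E V = (\<Inter>n\<in>V. A n)"
      unfolding E_def using False ev sets.sets_into_space by blast
    moreover have "(\<Inter>n\<in>V. A n) \<in> events" using False fin ev by (intro sets.finite_INT) auto
    moreover have "prob (\<Inter>n\<in>V. A n) = (\<Prod>n\<in>V. prob (A n))"
      using ind U False fin \<open>V \<subseteq> U\<close> unfolding indep_events_def by blast
    ultimately show ?thesis by simp
  qed
  define g where "g \<omega> = (\<Sum>V\<in>Pow U. (\<Prod>n\<in>V. \<beta> n) * (\<Prod>n\<in>U - V. \<alpha> n) * of_real (indicator (E V) \<omega>))" for \<omega>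
  have ind_E: "of_real (indicator (E V) \<omega>) = (\<Prod>n\<in>V. indicator (A n) \<omega> :: complex)"
    if "\<omega> \<in> space M" "V \<subseteq> U" for \<omega> V
  proof (cases "\<forall>n\<in>V. \<omega> \<in> A n")
    case False
    have "finite V" using U that finite_subset by auto
    then have "(\<Prod>n\<in>V. indicator (A n) \<omega> :: complex) = 0"
      using False by (auto simp: indicator_def)
    then show ?thesis using False by (simp add: E_def)
  qed (use that in \<open>simp add: E_def\<close>)
  have fg: "?f \<omega> = g \<omega>" if "\<omega> \<in> space M" for \<omega>
    \<comment> \<open>Expanding the product leaves only indicators of intersections, where independence applies.\<close>
    unfolding prod_add[OF U(1)] g_def
    by (intro sum.cong) (use that in \<open>auto simp: ind_E prod.distrib\<close>)
  have intE: "integrable M (indicator (E V) :: _ \<Rightarrow> real)" if "V \<subseteq> U" for V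
    using E[OF that] by (simp add: emeasure_eq_measure)
  have int: "integrable M (\<lambda>\<omega>. c * complex_of_real (indicator (E V) \<omega>))" if "V \<subseteq> U" for V c
    using intE[OF that] by (intro integrable_mult_right integrable_of_real)
  have "integrable M g" unfolding g_def by (intro Bochner_Integration.integrable_sum int) auto
  then show "integrable M ?f" using fg by (simp cong: Bochner_Integration.integrable_cong)
  have "integral\<^sup>L M ?f = integral\<^sup>L M g" using fg by (intro Bochner_Integration.integral_cong) auto
  also have "\<dots> = (\<Sum>V\<in>Pow U. (\<integral>\<omega>. (\<Prod>n\<in>V. \<beta> n) * (\<Prod>n\<in>U - V. \<alpha> n) * of_real (indicator (E V) \<omega>) \<partial>M))"
    unfolding g_def by (intro Bochner_Integration.integral_sum int) auto
  also have "\<dots> = (\<Sum>V\<in>Pow U. (\<Prod>n\<in>V. \<beta> n * prob (A n)) * (\<Prod>n\<in>U - V. \<alpha> n))"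
  proof (intro sum.cong refl)
    fix V assume "V \<in> Pow U"
    then have V: "V \<subseteq> U" by simp
    have "(\<integral>\<omega>. complex_of_real (indicator (E V) \<omega>) \<partial>M) = of_real (prob (E V))"
      using E[OF V] by (simp add: integral_complex_of_real)
    then show "(\<integral>\<omega>. (\<Prod>n\<in>V. \<beta> n) * (\<Prod>n\<in>U - V. \<alpha> n) * of_real (indicator (E V) \<omega>) \<partial>M)
        = (\<Prod>n\<in>V. \<beta> n * prob (A n)) * (\<Prod>n\<in>U - V. \<alpha> n)"
      using E[OF V] intE[OF V] by (simp add: prod.distrib)
  qed
  also have "\<dots> = (\<Prod>n\<in>U. \<beta> n * prob (A n) + \<alpha> n)"
    by (rule prod_add[OF U(1), symmetric])
  finally show "integral\<^sup>L M ?f = (\<Prod>n\<in>U. \<beta> n * prob (A n) + \<alpha> n)" .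
qed

text \<open>Every finite subset of \<open>A\<close> lies in some \<open>K N\<close>, so the
  exhaustion is cofinal among the finite subsets. This turns unordered sums into sequential limits,
  as dominated convergence requires.\<close>

lemma has_sum_imp_sequence_limit:
  assumes f: "(f has_sum L) A" and fin: "\<And>N. finite (K N)" and K: "incseq K" "(\<Union>N. K N) = A"
  shows "(\<lambda>N. sum f (K N)) \<longlonglongrightarrow> L"
proof -
  have "filterlim K (finite_subsets_at_top A) sequentially"
  proof (unfold filterlim_finite_subsets_at_top, intro allI impI)
    fix F assume F: "finite F \<and> F \<subseteq> A"
    obtain N where N: "F \<subseteq> K N"
    proof -
      from F have "\<exists>N. F \<subseteq> K N"
      proof (induction F rule: infinite_finite_induct)
        case (insert x F)
        then obtain N where N: "F \<subseteq> K N" by auto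
        obtain N' where "x \<in> K N'" using insert.prems K by auto
        then have "insert x F \<subseteq> K (max N N')"
          using N incseqD[OF K(1), of N "max N N'"] incseqD[OF K(1), of N' "max N N'"] by auto
        then show ?case by blast
      qed auto
      then show ?thesis using that by blast
    qed
    then show "\<forall>\<^sub>F N in sequentially. finite (K N) \<and> F \<subseteq> K N \<and> K N \<subseteq> A"
      using fin K(2) order_trans[OF N incseqD[OF K(1)]] unfolding eventually_sequentially by blast
  qed
  from filterlim_compose[OF f[unfolded has_sum_def] this] show ?thesis .
qed

text \<open>Dominated convergence along finite pieces of an enumeration of \<open>A\<close>; the
  constant \<open>infsum g A\<close> dominates all partial sums and is integrable on a probability
  space.\<close>

lemma (in prob_space) expectation_infsum:
  fixes f :: "'i \<Rightarrow> 'a \<Rightarrow> complex" and g :: "'i \<Rightarrow> real"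
  assumes A: "countable A" and int: "\<And>S. S \<in> A \<Longrightarrow> integrable M (f S)"
    and bound: "\<And>S \<omega>. S \<in> A \<Longrightarrow> \<omega> \<in> space M \<Longrightarrow> norm (f S \<omega>) \<le> g S" and g: "g summable_on A"
  shows "integrable M (\<lambda>\<omega>. \<Sum>\<^sub>\<infinity>S\<in>A. f S \<omega>)"
    and "(\<integral>\<omega>. (\<Sum>\<^sub>\<infinity>S\<in>A. f S \<omega>) \<partial>M) = (\<Sum>\<^sub>\<infinity>S\<in>A. \<integral>\<omega>. f S \<omega> \<partial>M)"
proof -
  define K where "K N = {S \<in> A. to_nat_on A S \<le> N}" for N
  have fin: "finite (K N)" for N
  proof (rule finite_imageD)
    show "finite (to_nat_on A ` K N)"
      by (rule finite_subset[of _ "{..N}"]) (auto simp: K_def)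
    show "inj_on (to_nat_on A) (K N)"
      by (rule inj_on_subset[OF inj_on_to_nat_on[OF A]]) (auto simp: K_def)
  qed
  have K: "\<And>N. finite (K N)" "incseq K" "(\<Union>N. K N) = A"
    using fin by (auto simp: incseq_def K_def)
  have KA: "K N \<subseteq> A" for N using K by auto
  \<comment> \<open>A probability space is nonempty, so \<open>g S\<close> dominates at least one
    actual norm.\<close>
  have g0: "0 \<le> g S" if "S \<in> A" for S
    using bound[OF that] not_empty by (meson all_not_in_conv norm_ge_zero order_trans)
  have sums: "f' summable_on A" if "\<And>S. S \<in> A \<Longrightarrow> norm (f' S :: complex) \<le> g S" for f'
  proof (rule abs_summable_summable)
    show "(\<lambda>S. norm (f' S)) summable_on A"
      by (rule summable_on_comparison_test[OF g]) (use that in auto)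
  qed
  have lim: "(\<lambda>N. \<Sum>S\<in>K N. f S \<omega>) \<longlonglongrightarrow> (\<Sum>\<^sub>\<infinity>S\<in>A. f S \<omega>)" if "\<omega> \<in> space M" for \<omega>
    by (rule has_sum_imp_sequence_limit[OF has_sum_infsum[OF sums] K]) (rule bound[OF _ that])
  have meas: "(\<lambda>\<omega>. \<Sum>S\<in>K N. f S \<omega>) \<in> borel_measurable M" for N
    using int KA by (intro borel_measurable_sum borel_measurable_integrable) auto
  have meas': "(\<lambda>\<omega>. \<Sum>\<^sub>\<infinity>S\<in>A. f S \<omega>) \<in> borel_measurable M"
    using lim meas by (rule borel_measurable_LIMSEQ_metric[rotated])
  have dom: "norm (\<Sum>S\<in>K N. f S \<omega>) \<le> infsum g A" if "\<omega> \<in> space M" for N \<omega>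
  proof -
    have "norm (\<Sum>S\<in>K N. f S \<omega>) \<le> (\<Sum>S\<in>K N. g S)"
      using bound that KA by (intro sum_norm_le) auto
    also have "\<dots> \<le> infsum g A"
      using K g KA g0 by (intro finite_sum_le_infsum) auto
    finally show ?thesis .
  qed
  have ae: "AE \<omega> in M. (\<lambda>N. \<Sum>S\<in>K N. f S \<omega>) \<longlonglongrightarrow> (\<Sum>\<^sub>\<infinity>S\<in>A. f S \<omega>)"
    "\<And>N. AE \<omega> in M. norm (\<Sum>S\<in>K N. f S \<omega>) \<le> infsum g A"
    using lim dom by auto
  show "integrable M (\<lambda>\<omega>. \<Sum>\<^sub>\<infinity>S\<in>A. f S \<omega>)"
    by (rule integrable_dominated_convergence[OF meas' meas _ ae]) simp
  have "(\<lambda>N. \<integral>\<omega>. (\<Sum>S\<in>K N. f S \<omega>) \<partial>M) \<longlonglongrightarrow> (\<integral>\<omega>. (\<Sum>\<^sub>\<infinity>S\<in>A. f S \<omega>) \<partial>M)"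
    by (rule integral_dominated_convergence[OF meas' meas _ ae]) simp
  moreover have "(\<integral>\<omega>. (\<Sum>S\<in>K N. f S \<omega>) \<partial>M) = (\<Sum>S\<in>K N. \<integral>\<omega>. f S \<omega> \<partial>M)" for N
    using int KA by (intro Bochner_Integration.integral_sum) auto
  moreover have "(\<lambda>N. \<Sum>S\<in>K N. \<integral>\<omega>. f S \<omega> \<partial>M) \<longlonglongrightarrow> (\<Sum>\<^sub>\<infinity>S\<in>A. \<integral>\<omega>. f S \<omega> \<partial>M)"
  proof (rule has_sum_imp_sequence_limit[OF has_sum_infsum[OF sums] K])
    fix S assume S: "S \<in> A"
    have "norm (\<integral>\<omega>. f S \<omega> \<partial>M) \<le> (\<integral>\<omega>. norm (f S \<omega>) \<partial>M)"
      by simp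
    also have "\<dots> \<le> (\<integral>\<omega>. g S \<partial>M)"
      using int[OF S] bound[OF S] by (intro integral_mono) auto
    finally show "norm (\<integral>\<omega>. f S \<omega> \<partial>M) \<le> g S" by (simp add: prob_space)
  qed
  ultimately show "(\<integral>\<omega>. (\<Sum>\<^sub>\<infinity>S\<in>A. f S \<omega>) \<partial>M) = (\<Sum>\<^sub>\<infinity>S\<in>A. \<integral>\<omega>. f S \<omega> \<partial>M)"
    using LIMSEQ_unique by auto
qed

section \<open>The summand as a product weight and its expectation\<close>

text \<open>The \<open>i\<close>-th smallest of \<open>k\<close> points has rank
  \<open>k + 1 - i\<close> from above, which translates between the two ways of indexing.\<close>

lemma prod_nth_elem:
  fixes f :: "nat \<Rightarrow> int \<Rightarrow> 'c::comm_monoid_mult"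
  assumes S: "finite S" "card S = k"
  shows "(\<Prod>i=1..k. f i (nth_elem S i)) = (\<Prod>n\<in>S. f (k + 1 - rank_above S n) n)"
proof -
  define xs where "xs = sorted_list_of_set S"
  have xs: "length xs = k" "set xs = S" "distinct xs" "sorted xs"
    using S by (auto simp: xs_def)
  have nth_le: "xs ! i \<le> xs ! j \<longleftrightarrow> i \<le> j" if "i < k" "j < k" for i j
    using xs that sorted_nth_mono[OF xs(4), of i j] sorted_nth_mono[OF xs(4), of j i]
      nth_eq_iff_index_eq[OF xs(3), of i j] by (metis antisym linorder_le_cases)
  have rank: "rank_above S (nth_elem S i) = k + 1 - i" if "i \<in> {1..k}" for i
  proof -
    \<comment> \<open>List positions start at 0 while \<open>nth_elem\<close> starts at 1, so the
      points from the \<open>i\<close>-th on occupy positions \<open>i - 1\<close> to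
      \<open>k - 1\<close>.\<close>
    have "{x \<in> S. nth_elem S i \<le> x} = (\<lambda>j. xs ! j) ` {i - 1..<k}"
    proof (intro Set.set_eqI iffI)
      fix x assume "x \<in> {x \<in> S. nth_elem S i \<le> x}"
      then obtain j where "j < k" "x = xs ! j" "xs ! (i - 1) \<le> xs ! j"
        using xs(1,2) by (auto simp: in_set_conv_nth nth_elem_def simp flip: xs_def)
      then show "x \<in> (\<lambda>j. xs ! j) ` {i - 1..<k}" using nth_le[of "i - 1" j] that by auto
    next
      fix x assume "x \<in> (\<lambda>j. xs ! j) ` {i - 1..<k}"
      then obtain j where j: "i - 1 \<le> j" "j < k" "x = xs ! j" by auto
      then have "xs ! j \<in> S" "xs ! (i - 1) \<le> xs ! j"
        using nth_le[of "i - 1" j] xs(1,2) nth_mem[of j xs] that by auto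
      then show "x \<in> {x \<in> S. nth_elem S i \<le> x}"
        using j by (simp add: nth_elem_def flip: xs_def)
    qed
    moreover have "inj_on (\<lambda>j. xs ! j) {i - 1..<k}"
      using xs by (auto simp: inj_on_def nth_eq_iff_index_eq)
    ultimately show ?thesis unfolding rank_above_def using that by (simp add: card_image)
  qed
  have inj: "inj_on (nth_elem S) {1..k}"
    using rank by (intro inj_on_inverseI[where g = "\<lambda>n. k + 1 - rank_above S n"]) auto
  have "nth_elem S ` {1..k} \<subseteq> S"
    using xs nth_mem[of _ xs] by (auto simp: nth_elem_def simp flip: xs_def)
  then have "nth_elem S ` {1..k} = S"
    using S card_image[OF inj] by (intro card_subset_eq) auto
  with inj have "bij_betw (nth_elem S) {1..k} S" by (simp add: bij_betw_def)
  from prod.reindex_bij_betw[OF this, of "\<lambda>n. f (k + 1 - rank_above S n) n", symmetric]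
  show ?thesis using rank by (auto intro!: prod.cong)
qed

text \<open>The pairs are grouped by their second component \<open>v\<close>, which is a positive
  site not above the maximum of \<open>S\<close>; its rank counts the admissible
  \<open>u\<close>.\<close>

lemma sigma_pairs_eq_sum:
  assumes "finite S" "Y \<subseteq> {1..}"
  shows "sigma_pairs S Y = (\<Sum>n\<in>sites 0 S \<inter> Y. rank_above S n)"
proof -
  have "{(u, v). u \<in> S \<and> v \<in> Y \<and> u \<ge> v}
      = (\<lambda>(v, u). (u, v)) ` (SIGMA n : sites 0 S \<inter> Y. {x \<in> S. n \<le> x})"
    using assms(2) by (force simp: sites_def image_iff)
  moreover have "inj_on (\<lambda>(v, u). (u, v)) A" for A :: "(int \<times> int) set"
    by (auto simp: inj_on_def)
  ultimately show ?thesis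
    using assms(1) finite_sites[OF assms(1)] by (simp add: sigma_pairs_def card_image rank_above_def)
qed

text \<open>A chosen site outside \<open>Y\<close> has weight 0, which removes every
  \<open>S\<close> not contained in \<open>Y\<close>. The sum over subsets of the random
  \<open>Y\<close> can therefore run over the fixed family \<open>ksets 0 k\<close>.\<close>

lemma subset_term_eq_wt:
  assumes S: "S \<in> ksets 0 k" and Y: "Y \<subseteq> {1..}"
    and \<zeta>: "\<And>i. i \<in> {1..k} \<Longrightarrow> \<zeta> (k + 1 - i) = \<xi> i"
  shows "wt (\<lambda>c n. if n \<in> Y then of_real (\<tau> ^ c) * \<zeta> c powi (- n) else 0)
      (\<lambda>c n. if n \<in> Y then of_real (\<tau> ^ c) else 1) 0 S
    = (if S \<subseteq> Y then subset_term \<tau> k \<xi> Y S else 0)" (is "wt ?a ?b 0 S = _")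
proof (cases "S \<subseteq> Y")
  case True
  have S': "finite S" "card S = k" "S \<subseteq> sites 0 S"
    using S subset_sites by (auto simp: ksets_def)
  note fin = finite_sites[OF S'(1), of 0]
  have "wt ?a ?b 0 S = (\<Prod>n\<in>sites 0 S. (if n \<in> Y then of_real (\<tau> ^ rank_above S n) else 1) *
      (if n \<in> S then \<zeta> (rank_above S n) powi (- n) else 1))"
    unfolding wt_def using True by (intro prod.cong) auto
  also have "\<dots> = (\<Prod>n\<in>sites 0 S. if n \<in> Y then of_real (\<tau> ^ rank_above S n) else 1) *
      (\<Prod>n\<in>sites 0 S. if n \<in> S then \<zeta> (rank_above S n) powi (- n) else 1)"
    by (simp add: prod.distrib)
  also have "(\<Prod>n\<in>sites 0 S. if n \<in> Y then of_real (\<tau> ^ rank_above S n) else 1)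
      = complex_of_real (\<tau> ^ sigma_pairs S Y)"
    unfolding sigma_pairs_eq_sum[OF S'(1) Y] power_sum of_real_prod
    using fin by (auto simp: prod.inter_restrict intro!: prod.cong)
  also have "(\<Prod>n\<in>sites 0 S. if n \<in> S then \<zeta> (rank_above S n) powi (- n) else 1)
      = (\<Prod>n\<in>S. \<zeta> (rank_above S n) powi (- n))"
    using S' fin by (subst prod.mono_neutral_cong_right[of "sites 0 S" S]) auto
  \<comment> \<open>Ranks lie in \<open>{1..k}\<close>, so the double reversal is exact for natural
    subtraction; it exposes the ascending index.\<close>
  also have "\<dots> = (\<Prod>n\<in>S. \<zeta> (k + 1 - (k + 1 - rank_above S n)) powi (- n))"
    using bij_betwE[OF bij_betw_rank_above[OF S'(1)]] S'(2) by (intro prod.cong) auto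
  also have "\<dots> = (\<Prod>i=1..k. \<zeta> (k + 1 - i) powi (- nth_elem S i))"
    using prod_nth_elem[OF S'(1,2), of "\<lambda>i n. \<zeta> (k + 1 - i) powi (- n)"] by simp
  also have "\<dots> = (\<Prod>i=1..k. \<xi> i powi (- nth_elem S i))"
    using \<zeta> by (intro prod.cong) auto
  finally show ?thesis using True by (simp add: subset_term_def)
next
  case False
  then obtain n where n: "n \<in> S" "n \<notin> Y" by auto
  have "finite S" "n \<in> sites 0 S" using S n subset_sites by (auto simp: ksets_def)
  then have "wt ?a ?b 0 S = 0"
    unfolding wt_def using n finite_sites by (intro prod_zero) auto
  then show ?thesis using False by simp
qed

text \<open>With \<open>I\<close> the indicator of \<open>n \<in> Y\<close>, a chosen site has
  factor \<open>x * I\<close> and an unchosen one \<open>1 + (y - 1) * I\<close>. The coefficients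
  \<open>\<alpha>\<close> and \<open>\<beta>\<close> encode both cases for the product
  formula.\<close>

lemma (in prob_space) expectation_wt:
  fixes x y :: "nat \<Rightarrow> int \<Rightarrow> complex" and \<rho> :: "int \<Rightarrow> real"
  assumes ind: "indep_events (\<lambda>n. {\<omega> \<in> space M. n \<in> Y \<omega>}) {1..}"
    and prob: "\<And>n. n \<ge> 1 \<Longrightarrow> prob {\<omega> \<in> space M. n \<in> Y \<omega>} = \<rho> n"
    and S: "S \<in> ksets 0 k"
  shows "integrable M (\<lambda>\<omega>. wt (\<lambda>c n. if n \<in> Y \<omega> then x c n else 0) (\<lambda>c n. if n \<in> Y \<omega> then y c n else 1) 0 S)"
    (is "integrable M ?f")
    and "(\<integral>\<omega>. wt (\<lambda>c n. if n \<in> Y \<omega> then x c n else 0) (\<lambda>c n. if n \<in> Y \<omega> then y c n else 1) 0 S \<partial>M)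
      = wt (\<lambda>c n. x c n * of_real (\<rho> n)) (\<lambda>c n. 1 - of_real (\<rho> n) + y c n * of_real (\<rho> n)) 0 S"
proof -
  define A where "A n = {\<omega> \<in> space M. n \<in> Y \<omega>}" for n
  define \<alpha> :: "int \<Rightarrow> complex" where "\<alpha> n = (if n \<in> S then 0 else 1)" for n
  define \<beta> where "\<beta> n = (if n \<in> S then x (rank_above S n) n else y (rank_above S n) n - 1)" for n
  have fin: "finite (sites 0 S)" and sub: "sites 0 S \<subseteq> {1..}"
    using S finite_sites by (auto simp: ksets_def sites_def)
  note E = expectation_prod_indep_events[OF ind[folded A_def] fin sub, of \<beta> \<alpha>]
  have eq: "?f \<omega> = (\<Prod>n\<in>sites 0 S. \<beta> n * indicator (A n) \<omega> + \<alpha> n)" if "\<omega> \<in> space M" for \<omega>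
    unfolding wt_def using that by (intro prod.cong) (auto simp: \<alpha>_def \<beta>_def A_def)
  show "integrable M ?f"
    using E(1) eq by (simp cong: Bochner_Integration.integrable_cong)
  have "integral\<^sup>L M ?f = (\<Prod>n\<in>sites 0 S. \<beta> n * prob (A n) + \<alpha> n)"
    using E(2) eq by (simp cong: Bochner_Integration.integral_cong)
  also have "\<dots> = wt (\<lambda>c n. x c n * of_real (\<rho> n)) (\<lambda>c n. 1 - of_real (\<rho> n) + y c n * of_real (\<rho> n)) 0 S"
    unfolding wt_def
  proof (intro prod.cong refl)
    fix n assume "n \<in> sites 0 S"
    then have "prob (A n) = \<rho> n" using sub prob by (auto simp: A_def)
    then show "\<beta> n * prob (A n) + \<alpha> n = (if n \<in> S then \<lambda>c n. x c n * of_real (\<rho> n)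
        else (\<lambda>c n. 1 - of_real (\<rho> n) + y c n * of_real (\<rho> n))) (rank_above S n) n"
      by (simp add: \<alpha>_def \<beta>_def algebra_simps)
  qed
  finally show "integral\<^sup>L M ?f = wt (\<lambda>c n. x c n * of_real (\<rho> n)) (\<lambda>c n. 1 - of_real (\<rho> n) + y c n * of_real (\<rho> n)) 0 S" .
qed

section \<open>Periodicity, the linear system and the matrix product\<close>

text \<open>Advancing the window by one drops the factor at \<open>\<mu> + 1\<close> and adds the
  equal factor one period later.\<close>

lemma prod_full_period:
  fixes f :: "int \<Rightarrow> 'c::comm_monoid_mult"
  assumes "\<And>n. f (n + int m) = f n"
  shows "(\<Prod>n=int \<mu> + 1..int \<mu> + int m. f n) = (\<Prod>n=1..int m. f n)"
proof (induction \<mu>)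
  case (Suc \<mu>)
  show ?case
  proof (cases "m = 0")
    case False
    define I where "I = {int \<mu> + 2..int \<mu> + int m}"
    have "{int (Suc \<mu>) + 1..int (Suc \<mu>) + int m} = insert (int \<mu> + 1 + int m) I"
      "{int \<mu> + 1..int \<mu> + int m} = insert (int \<mu> + 1) I"
      using False unfolding I_def by auto
    moreover have "int \<mu> + 1 + int m \<notin> I" "int \<mu> + 1 \<notin> I" "finite I" by (auto simp: I_def)
    ultimately show ?thesis using Suc.IH assms by simp
  qed simp
qed simp

text \<open>The window holds one representative of each residue: \<open>\<nu>\<close> itself if
  \<open>\<nu> > \<mu>\<close>, otherwise \<open>\<nu> + m\<close>. This is the origin of the case
  split in the matrix entries.\<close>

lemma sum_window:
  fixes h :: "int \<Rightarrow> 'c::comm_monoid_add"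
  assumes "\<mu> < m"
  shows "(\<Sum>t\<in>{int \<mu> + 1..int \<mu> + int m}. h t)
    = (\<Sum>\<nu><m. if \<mu> < \<nu> then h (int \<nu>) else h (int \<nu> + int m))"
proof -
  have "(\<Sum>\<nu><m. if \<mu> < \<nu> then h (int \<nu>) else h (int \<nu> + int m))
      = (\<Sum>\<nu><m. h (if \<mu> < \<nu> then int \<nu> else int \<nu> + int m))"
    by (intro sum.cong) auto
  also have "\<dots> = (\<Sum>t\<in>{int \<mu> + 1..int \<mu> + int m}. h t)"
    by (rule sum.reindex_bij_witness[of _ "\<lambda>t. nat (if t < int m then t else t - int m)"
          "\<lambda>\<nu>. if \<mu> < \<nu> then int \<nu> else int \<nu> + int m"])
      (use assms in auto)
  finally show ?thesis ..
qed

text \<open>Unrolling over exactly one period returns the unknown sum multiplied by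
  \<open>P * E\<close>, and \<open>P * E \<noteq> 1\<close> makes the equation solvable.\<close>

lemma wt_sum_linear_system:
  assumes summable: "\<And>s j. 0 \<le> s \<Longrightarrow> wt a b s summable_on ksets s j"
    and a: "\<And>c n. a c (n + int m) = e c * a c n" and b: "\<And>c n. b c (n + int m) = b c n"
    and E: "E = (\<Prod>c=1..Suc j. e c)" and P: "P = (\<Prod>n=1..int m. b (Suc j) n)"
    and PE: "P * E \<noteq> 1" and \<mu>: "\<mu> < m"
  shows "wt_sum a b (Suc j) (int \<mu>) = (\<Sum>\<nu><m. 1 / (1 - P * E) *
    (if \<mu> < \<nu> then (\<Prod>n=int \<mu> + 1..int \<nu> - 1. b (Suc j) n)
     else E * (\<Prod>n=int \<mu> + 1..int \<nu> + int m - 1. b (Suc j) n)) * a (Suc j) (int \<nu>) * wt_sum a b j (int \<nu>))"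
    (is "?T = (\<Sum>\<nu><m. 1 / (1 - P * E) * ?p \<nu> * _ \<nu> * _ \<nu>)")
proof -
  define h where "h t = (\<Prod>n=int \<mu> + 1..t - 1. b (Suc j) n) * a (Suc j) t * wt_sum a b j t" for t
  \<comment> \<open>For a wrapped index the chosen weight gives \<open>e (Suc j)\<close> and the
    lower sum gives \<open>e\<close> at the ranks up to \<open>j\<close>; together they form
    \<open>E\<close>.\<close>
  have h: "h (int \<nu> + int m) = E * (\<Prod>n=int \<mu> + 1..int \<nu> + int m - 1. b (Suc j) n) *
      a (Suc j) (int \<nu>) * wt_sum a b j (int \<nu>)" for \<nu>
    unfolding h_def wt_sum_shift[of a "int m" e b, OF a b] a E by simp
  have "?T = (\<Sum>t\<in>{int \<mu> + 1..int \<mu> + int m}. h t) +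
      (\<Prod>n=int \<mu> + 1..int \<mu> + int m. b (Suc j) n) * wt_sum a b (Suc j) (int \<mu> + int m)"
    unfolding h_def by (rule wt_sum_unroll[OF summable]) auto
  also have "(\<Prod>n=int \<mu> + 1..int \<mu> + int m. b (Suc j) n) = P"
    unfolding P by (rule prod_full_period) (rule b)
  also have "wt_sum a b (Suc j) (int \<mu> + int m) = E * ?T"
    unfolding E by (rule wt_sum_shift[of a "int m" e b, OF a b])
  also have "(\<Sum>t\<in>{int \<mu> + 1..int \<mu> + int m}. h t) =
      (\<Sum>\<nu><m. ?p \<nu> * a (Suc j) (int \<nu>) * wt_sum a b j (int \<nu>))" (is "_ = ?R")
    unfolding sum_window[OF \<mu>] h by (intro sum.cong) (auto simp: h_def)
  finally have *: "?T = ?R + P * (E * ?T)" .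
  have "t = 1 / (1 - P * E) * u" if "t = u + P * (E * t)" for t u
    using that PE by (simp add: field_simps)
  from this[OF *] have "?T = 1 / (1 - P * E) * ?R" .
  then show ?thesis by (simp add: sum_distrib_left mult.assoc)
qed

text \<open>Evaluated from the right, the last \<open>j\<close> matrices turn the all-ones vector
  into \<open>T j\<close>. The recursion runs against the matrix index, hence
  \<open>A (k - j)\<close>.\<close>

lemma foldr_mat_mult_vec:
  fixes A :: "nat \<Rightarrow> 'c::comm_semiring_1 Matrix.mat"
  assumes A: "\<And>i. A i \<in> carrier_mat m m" and T0: "\<And>\<mu>. \<mu> < m \<Longrightarrow> T 0 \<mu> = 1"
    and T: "\<And>j \<mu>. j < k \<Longrightarrow> \<mu> < m \<Longrightarrow> T (Suc j) \<mu> = (\<Sum>\<nu><m. A (k - j) $$ (\<mu>, \<nu>) * T j \<nu>)"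
    and "j \<le> k"
  shows "foldr (*) (map A [k + 1 - j..<k + 1]) (1\<^sub>m m) *\<^sub>v Matrix.vec m (\<lambda>_. 1) = Matrix.vec m (T j)"
  using \<open>j \<le> k\<close>
proof (induction j)
  case 0
  then show ?case using T0 by (auto intro!: eq_vecI)
next
  case (Suc j)
  define F where "F = foldr (*) (map A [k + 1 - j..<k + 1]) (1\<^sub>m m)"
  have "foldr (*) (map A xs) (1\<^sub>m m) \<in> carrier_mat m m" for xs
    by (induction xs) (auto intro!: mult_carrier_mat[of _ m m] A)
  then have F: "F \<in> carrier_mat m m" unfolding F_def .
  have "[k + 1 - Suc j..<k + 1] = (k - j) # [k + 1 - j..<k + 1]"
    using Suc.prems upt_conv_Cons[of "k - j" "k + 1"] by (simp add: Suc_diff_le)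
  then have "foldr (*) (map A [k + 1 - Suc j..<k + 1]) (1\<^sub>m m) *\<^sub>v Matrix.vec m (\<lambda>_. 1)
      = (A (k - j) * F) *\<^sub>v Matrix.vec m (\<lambda>_. 1)"
    by (simp add: F_def)
  also have "\<dots> = A (k - j) *\<^sub>v (F *\<^sub>v Matrix.vec m (\<lambda>_. 1))"
    by (rule assoc_mult_mat_vec[OF A F]) simp
  also have "F *\<^sub>v Matrix.vec m (\<lambda>_. 1) = Matrix.vec m (T j)"
    using Suc by (simp add: F_def)
  also have "A (k - j) *\<^sub>v Matrix.vec m (T j) = Matrix.vec m (T (Suc j))"
  proof (rule eq_vecI)
    fix \<mu> assume "\<mu> < dim_vec (Matrix.vec m (T (Suc j)))"
    then have "\<mu> < m" by simp
    then show "(A (k - j) *\<^sub>v Matrix.vec m (T j)) $ \<mu> = Matrix.vec m (T (Suc j)) $ \<mu>"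
      using A[of "k - j"] T[of j \<mu>] Suc.prems
      by (auto simp: scalar_prod_def lessThan_atLeast0 intro!: sum.cong)
  qed (use A[of "k - j"] in auto)
  finally show ?case .
qed

section \<open>The averaged sum as a matrix product\<close>

text \<open>Summability and integrability belong to the conclusion because infinite sums and
  integrals default to 0 without them.\<close>

theorem mainTheorem2:
  fixes p q R \<tau> :: real and m k :: nat and \<rho> :: "int \<Rightarrow> real"
    and \<xi> :: "nat \<Rightarrow> complex" and M :: "'a measure" and Y :: "'a \<Rightarrow> int set"
  assumes "p \<ge> 0" and "q \<ge> 0" and "p + q = 1" and "q \<noteq> 0" and "\<tau> = p / q"
    and "\<And>z z' :: complex. cmod z \<ge> R \<Longrightarrow> cmod z' \<ge> R \<Longrightarrow>
           of_real p + of_real q * z * z' - z \<noteq> 0"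
    and "m \<ge> 1"
    and "\<And>n. 0 \<le> \<rho> n \<and> \<rho> n \<le> 1"
    and "\<And>n. \<rho> (n + int m) = \<rho> n"
    and "prob_space M"
    and "\<And>\<omega>. \<omega> \<in> space M \<Longrightarrow> Y \<omega> \<subseteq> {1..}"
    and "prob_space.indep_events M (\<lambda>n. {\<omega> \<in> space M. n \<in> Y \<omega>}) {1..}"
    and "\<And>n. n \<ge> 1 \<Longrightarrow> measure M {\<omega> \<in> space M. n \<in> Y \<omega>} = \<rho> n"
    and "k \<ge> 1"
    and "\<And>i. i \<in> {1..k} \<Longrightarrow> \<xi> i \<in> sphere 0 R"
  shows "(\<forall>\<omega>\<in>space M.
            subset_term \<tau> k \<xi> (Y \<omega>) summable_on {S. S \<subseteq> Y \<omega> \<and> finite S \<and> card S = k}) \<and>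
         integrable M (\<lambda>\<omega>. \<Sum>\<^sub>\<infinity>S\<in>{S. S \<subseteq> Y \<omega> \<and> finite S \<and> card S = k}.
            subset_term \<tau> k \<xi> (Y \<omega>) S) \<and>
         (\<integral>\<omega>. (\<Sum>\<^sub>\<infinity>S\<in>{S. S \<subseteq> Y \<omega> \<and> finite S \<and> card S = k}.
            subset_term \<tau> k \<xi> (Y \<omega>) S) \<partial>M) =
         of_real (\<tau> ^ (k * (k + 1) div 2)) *
           scalar_prod (unit_vec m 0)
             (mat_prod m k (A_mat \<tau> \<rho> m k \<xi>) *\<^sub>v Matrix.vec m (\<lambda>_. 1))"
proof -
  interpret prob_space M by fact
  \<comment> \<open>The powers \<open>B ^ c\<close> bound both 1 and \<open>\<tau> ^ c\<close>,
    whichever of 1 and \<open>\<tau>\<close> is larger.\<close>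
  define B where "B = max 1 \<tau>"
  define r where "r = inverse R"
  have \<tau>: "0 \<le> \<tau>" "\<tau> \<le> B" "1 \<le> B" using assms(1,2,5) by (auto simp: B_def)
  \<comment> \<open>Both 1 and \<open>\<tau>\<close> are roots of \<open>p + q z\<^sup>2 - z\<close>, so the condition on \<open>R\<close> forces \<open>R > max 1 \<tau>\<close>.\<close>
  have "1 < R"
  proof (rule ccontr)
    assume "\<not> 1 < R"
    then have "complex_of_real (p + q) - 1 \<noteq> 0" using assms(6)[of 1 1] by simp
    then show False using assms(3) by simp
  qed
  moreover have "\<tau> < R"
  proof (rule ccontr)
    assume "\<not> \<tau> < R"
    then have "of_real p + of_real q * of_real \<tau> * of_real \<tau> - complex_of_real \<tau> \<noteq> 0"
      using assms(6)[of "of_real \<tau>" "of_real \<tau>"] \<tau> by simp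
    then have "p + q * \<tau> * \<tau> - \<tau> \<noteq> 0"
      by (simp flip: of_real_mult of_real_add of_real_diff)
    moreover have "q * \<tau> = p" using assms(4,5) by simp
    \<comment> \<open>Substituting \<open>q * \<tau> = p\<close> leaves
      \<open>p + p * \<tau> - \<tau>\<close>; by \<open>1 - p = q\<close> this is
      \<open>p - q * \<tau>\<close>, which vanishes.\<close>
    moreover have "p + p * \<tau> - \<tau> = p - q * \<tau>" using assms(3) by (simp add: algebra_simps flip: distrib_left)
    ultimately show False by simp
  qed
  ultimately have R: "0 < R" "B < R" using \<tau> by (auto simp: B_def)
  then have r: "0 \<le> r" "B * r < 1" by (auto simp: r_def field_simps)

  \<comment> \<open>The variables are relisted by rank from above. The default outside
    \<open>{1..k}\<close> also has norm \<open>R\<close>, so the weight bounds hold for every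
    \<open>c\<close>.\<close>
  define \<zeta> where "\<zeta> c = (if c \<in> {1..k} then \<xi> (k + 1 - c) else of_real R)" for c
  have \<zeta>: "norm (\<zeta> c) = R" for c 
  proof (cases "c \<in> {1..k}")
    case True
    then have "k + 1 - c \<in> {1..k}" by auto
    from assms(15)[OF this] True show ?thesis by (simp add: \<zeta>_def)
  qed (use R in \<open>auto simp: \<zeta>_def\<close>)
  have \<zeta>0: "\<zeta> c \<noteq> 0" for c using \<zeta>[of c] R by auto
  have \<zeta>\<xi>: "\<zeta> (k + 1 - i) = \<xi> i" if "i \<in> {1..k}" for i using that by (auto simp: \<zeta>_def)
  have norm_\<zeta>: "norm (\<zeta> c powi (- n)) = r ^ nat n" if "0 < n" for c n
    using that by (simp add: norm_power norm_inverse \<zeta> r_def power_int_def)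

  define aY where "aY \<omega> = (\<lambda>c n. if n \<in> Y \<omega> then of_real (\<tau> ^ c) * \<zeta> c powi (- n) else 0)" for \<omega>
  define bY where "bY \<omega> = (\<lambda>(c::nat) n. if n \<in> Y \<omega> then complex_of_real (\<tau> ^ c) else 1)" for \<omega>
  have \<tau>B: "\<tau> ^ c \<le> B ^ c" "1 \<le> B ^ c" for c using \<tau> by (auto intro: power_mono)
  have aY: "norm (aY \<omega> c n) \<le> B ^ c * r ^ nat n" if "0 < n" for \<omega> c n
    using norm_\<zeta>[OF that] \<tau> r \<tau>B by (auto simp: aY_def norm_mult norm_power intro!: mult_right_mono)
  have bY: "norm (bY \<omega> c n) \<le> B ^ c" for \<omega> c n
    using \<tau> \<tau>B by (auto simp: bY_def norm_power)
  have term_wt: "wt (aY \<omega>) (bY \<omega>) 0 S = (if S \<subseteq> Y \<omega> then subset_term \<tau> k \<xi> (Y \<omega>) S else 0)"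
    if "\<omega> \<in> space M" "S \<in> ksets 0 k" for \<omega> S
    unfolding aY_def bY_def using that assms(11) \<zeta>\<xi> by (intro subset_term_eq_wt) auto
  define K where "K \<omega> = {S. S \<subseteq> Y \<omega> \<and> finite S \<and> card S = k}" for \<omega>
  have sub: "K \<omega> \<subseteq> ksets 0 k" if "\<omega> \<in> space M" for \<omega>
    using assms(11)[OF that] by (fastforce simp: ksets_def K_def)
  have wt_in: "subset_term \<tau> k \<xi> (Y \<omega>) S = wt (aY \<omega>) (bY \<omega>) 0 S"
    if "\<omega> \<in> space M" "S \<in> K \<omega>" for \<omega> S
    using term_wt[OF that(1), of S] sub[OF that(1)] that(2) by (auto simp: K_def)
  have wt_notin: "wt (aY \<omega>) (bY \<omega>) 0 S = 0" if "\<omega> \<in> space M" "S \<in> ksets 0 k - K \<omega>" for \<omega> S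
    using term_wt[OF that(1), of S] that(2) by (auto simp: ksets_def K_def)
  have "wt (aY \<omega>) (bY \<omega>) 0 summable_on ksets 0 k" for \<omega>
    by (rule abs_summable_summable, rule abs_summable_wt[of 0 B r]) (use \<tau> r aY bY in auto)
  \<comment> \<open>Sets outside \<open>K \<omega>\<close> carry weight 0, so the random index
    family is replaced by the deterministic one.\<close>
  then have has_sum: "(subset_term \<tau> k \<xi> (Y \<omega>) has_sum (\<Sum>\<^sub>\<infinity>S\<in>ksets 0 k. wt (aY \<omega>) (bY \<omega>) 0 S)) (K \<omega>)"
    if "\<omega> \<in> space M" for \<omega>
  proof (subst has_sum_cong_neutral[where T = "ksets 0 k" and g = "wt (aY \<omega>) (bY \<omega>) 0"])
    show "subset_term \<tau> k \<xi> (Y \<omega>) S = 0" if "S \<in> K \<omega> - ksets 0 k" for S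
      using that sub[OF \<open>\<omega> \<in> space M\<close>] by auto
  qed (use that wt_in wt_notin in auto)
  then have summable: "subset_term \<tau> k \<xi> (Y \<omega>) summable_on K \<omega>" if "\<omega> \<in> space M" for \<omega>
    using that has_sum_imp_summable by blast
  have infsum: "(\<Sum>\<^sub>\<infinity>S\<in>K \<omega>. subset_term \<tau> k \<xi> (Y \<omega>) S)
      = (\<Sum>\<^sub>\<infinity>S\<in>ksets 0 k. wt (aY \<omega>) (bY \<omega>) 0 S)" if "\<omega> \<in> space M" for \<omega>
    using has_sum[OF that] by (rule infsumI)

  \<comment> \<open>The factor \<open>\<tau> ^ c\<close> of a chosen site is left out of
    \<open>a\<close>; over the ranks 1 to \<open>k\<close> it multiplies up to the prefactor of the
    formula.\<close>
  define a where "a c n = \<rho> n * \<zeta> c powi (- n)" for c n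
  define b where "b c n = complex_of_real (1 - \<rho> n + \<rho> n * \<tau> ^ c)" for c n
  have E: "integrable M (\<lambda>\<omega>. wt (aY \<omega>) (bY \<omega>) 0 S)"
    "(\<integral>\<omega>. wt (aY \<omega>) (bY \<omega>) 0 S \<partial>M) = wt (\<lambda>c n. of_real (\<tau> ^ c) * a c n) b 0 S"
    if "S \<in> ksets 0 k" for S
    using expectation_wt[OF assms(12,13) that, of "\<lambda>c n. of_real (\<tau> ^ c) * \<zeta> c powi (- n)" "\<lambda>c n. of_real (\<tau> ^ c)"]
    by (simp_all add: aY_def bY_def a_def b_def[abs_def] mult_ac)
  have countable: "countable (ksets 0 k)"
    by (rule countable_subset[OF _ countable_Collect_finite]) (auto simp: ksets_def)
  have bound: "norm (wt (aY \<omega>) (bY \<omega>) 0 S) \<le> (\<Prod>x\<in>S. (B * r) ^ nat x)" if "S \<in> ksets 0 k" for S \<omega>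
    using that \<tau> r bY by (intro norm_wt_le[of _ _ k] aY) (auto simp: ksets_def)
  have summable_bound: "(\<lambda>S. \<Prod>x\<in>S. (B * r) ^ nat x) summable_on ksets 0 k"
    using \<tau> r by (intro summable_prod_power) auto
  note E_infsum = expectation_infsum[OF countable E(1) bound summable_bound]
  have integrable: "integrable M (\<lambda>\<omega>. \<Sum>\<^sub>\<infinity>S\<in>K \<omega>. subset_term \<tau> k \<xi> (Y \<omega>) S)"
    using E_infsum(1) infsum by (simp cong: Bochner_Integration.integrable_cong)
  have "(\<integral>\<omega>. (\<Sum>\<^sub>\<infinity>S\<in>K \<omega>. subset_term \<tau> k \<xi> (Y \<omega>) S) \<partial>M)
      = wt_sum (\<lambda>c n. of_real (\<tau> ^ c) * a c n) b k 0"
    using E_infsum(2) infsum E(2)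
    by (simp add: wt_sum_def cong: Bochner_Integration.integral_cong infsum_cong)
  also have "\<dots> = of_real (\<Prod>c=1..k. \<tau> ^ c) * wt_sum a b k 0"
    by (subst wt_sum_mult_chosen) simp
  also have "(\<Prod>c=1..k. \<tau> ^ c) = \<tau> ^ (k * (k + 1) div 2)"
    unfolding power_sum[symmetric] Sum_Icc_nat by simp
  also have "wt_sum a b k 0 = scalar_prod (unit_vec m 0)
      (mat_prod m k (A_mat \<tau> \<rho> m k \<xi>) *\<^sub>v Matrix.vec m (\<lambda>_. 1))"
  proof -
    have norm_b: "norm (b c n) \<le> B ^ c" for c n
    proof -
      \<comment> \<open>The left side is a convex combination of 1 and \<open>\<tau> ^ c\<close>,
        both at most \<open>B ^ c\<close>.\<close>
      have "1 - \<rho> n + \<rho> n * \<tau> ^ c \<le> (1 - \<rho> n) * B ^ c + \<rho> n * B ^ c"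
        using mult_left_mono[OF \<tau>B(1)[of c], of "\<rho> n"] mult_left_mono[OF \<tau>B(2)[of c], of "1 - \<rho> n"]
          assms(8)[of n] by simp
      moreover have "0 \<le> 1 - \<rho> n + \<rho> n * \<tau> ^ c" using assms(8)[of n] \<tau> by simp
      ultimately show ?thesis unfolding b_def norm_of_real by (simp add: algebra_simps)
    qed
    have norm_a: "norm (a c n) \<le> B ^ c * r ^ nat n" if "0 < n" for c n
      using norm_\<zeta>[OF that] assms(8)[of n] \<tau>B[of c] r by (auto simp: a_def norm_mult intro!: mult_right_mono)
    have summable_ab: "wt a b s summable_on ksets s j" if "0 \<le> s" for s j
      by (rule abs_summable_summable, rule abs_summable_wt[of s B r])
        (use that \<tau> r norm_a norm_b in auto)
    \<comment> \<open>A shift by one period leaves \<open>\<rho>\<close> alone and multiplies the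
      chosen weight of rank \<open>c\<close> by \<open>e c\<close>.\<close>
    define e where "e c = \<zeta> c powi (- int m)" for c
    have a_per: "a c (n + int m) = e c * a c n" for c n
      using assms(9) \<zeta>0 by (simp add: a_def e_def power_int_diff power_int_minus divide_inverse mult_ac)
    have b_per: "b c (n + int m) = b c n" for c n
      using assms(9) by (simp add: b_def)
    have rec: "wt_sum a b (Suc j) (int \<mu>) = (\<Sum>\<nu><m. A_mat \<tau> \<rho> m k \<xi> (k - j) $$ (\<mu>, \<nu>) * wt_sum a b j (int \<nu>))"
      if j: "j < k" and \<mu>: "\<mu> < m" for j \<mu>
    proof -
      define D where "D = (\<Prod>i=k - j..k. \<xi> i)"
      define P where "P = (\<Prod>n=1..int m. b (Suc j) n)"
      have phi: "of_real (phi \<tau> \<rho> k (k - j) n) = b (Suc j) n" for n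
        using j by (simp add: phi_def b_def)
      have \<zeta>_j: "\<zeta> (Suc j) = \<xi> (k - j)" using j by (simp add: \<zeta>_def)
      \<comment> \<open>Ranks 1 to \<open>j + 1\<close> correspond to the indices \<open>k\<close>
        down to \<open>k - j\<close>.\<close>
      have "D = (\<Prod>c=1..Suc j. \<zeta> c)"
        unfolding D_def
        by (rule prod.reindex_bij_witness[of _ "\<lambda>c. k + 1 - c" "\<lambda>i. k + 1 - i"]) (use j in \<open>auto simp: \<zeta>_def\<close>)
      then have E: "inverse (D ^ m) = (\<Prod>c=1..Suc j. e c)" and D: "norm D = R ^ Suc j"
        using prod_norm[of \<zeta> "{1..Suc j}"] prod_inversef[of "\<lambda>c. \<zeta> c ^ m" "{1..Suc j}"]
        by (simp_all add: e_def power_int_minus \<zeta> o_def del: prod.cl_ivl_Suc flip: prod_power_distrib)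
      have D0: "D \<noteq> 0" using D R by auto
      \<comment> \<open>The denominator cannot vanish: \<open>P\<close> has norm at most
        \<open>(B ^ Suc j) ^ m\<close>, strictly below the norm \<open>(R ^ Suc j) ^ m\<close> of
        \<open>D ^ m\<close> because \<open>B < R\<close> and \<open>m \<ge> 1\<close>.\<close>
      have "norm P \<le> (\<Prod>n=1..int m. B ^ Suc j)"
        unfolding P_def prod_norm[symmetric] using norm_b[of "Suc j"] by (intro prod_mono) auto
      also have "\<dots> = (B ^ Suc j) ^ m" by simp
      also have "\<dots> < (R ^ Suc j) ^ m"
        using R \<tau> assms(7) by (intro power_strict_mono) auto
      finally have "norm P < norm (D ^ m)" by (simp add: D norm_power)
      then have DP: "D ^ m \<noteq> P" by auto
      then have PE: "P * inverse (D ^ m) \<noteq> 1" using D0 by (simp add: field_simps)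
      \<comment> \<open>Expanding by \<open>D ^ m\<close> produces the denominator of the matrix
        entry; the numerator \<open>D ^ m\<close> survives for \<open>\<mu> < \<nu>\<close> and
        cancels against \<open>inverse (D ^ m)\<close> otherwise.\<close>
      have coeff: "1 / (1 - P * inverse (D ^ m)) = D ^ m / (D ^ m - P)"
        using D0 DP by (simp add: field_simps)
      have entry: "D ^ m / (D ^ m - P) *
            (if \<mu> < \<nu> then (\<Prod>n=int \<mu> + 1..int \<nu> - 1. b (Suc j) n)
             else inverse (D ^ m) * (\<Prod>n=int \<mu> + 1..int \<nu> + int m - 1. b (Suc j) n)) *
            a (Suc j) (int \<nu>) = A_mat \<tau> \<rho> m k \<xi> (k - j) $$ (\<mu>, \<nu>)" if "\<nu> < m" for \<nu>
        using that \<mu> D0 by (simp add: A_mat_def A_entry_def phi a_def \<zeta>_j flip: D_def P_def)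
      have "wt_sum a b (Suc j) (int \<mu>) = (\<Sum>\<nu><m. D ^ m / (D ^ m - P) *
            (if \<mu> < \<nu> then (\<Prod>n=int \<mu> + 1..int \<nu> - 1. b (Suc j) n)
             else inverse (D ^ m) * (\<Prod>n=int \<mu> + 1..int \<nu> + int m - 1. b (Suc j) n)) *
            a (Suc j) (int \<nu>) * wt_sum a b j (int \<nu>))"
        unfolding coeff[symmetric]
        by (rule wt_sum_linear_system[where e = e, OF summable_ab a_per b_per E P_def PE \<mu>])
      also have "\<dots> = (\<Sum>\<nu><m. A_mat \<tau> \<rho> m k \<xi> (k - j) $$ (\<mu>, \<nu>) * wt_sum a b j (int \<nu>))"
        by (rule sum.cong[OF refl], subst entry) simp_all
      finally show ?thesis .
    qed
    have "mat_prod m k (A_mat \<tau> \<rho> m k \<xi>) *\<^sub>v Matrix.vec m (\<lambda>_. 1) = Matrix.vec m (\<lambda>\<mu>. wt_sum a b k (int \<mu>))"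
      using foldr_mat_mult_vec[of "A_mat \<tau> \<rho> m k \<xi>" m "\<lambda>j \<mu>. wt_sum a b j (int \<mu>)" k k] rec
      by (simp add: mat_prod_def A_mat_def wt_sum_0)
    then show ?thesis using assms(7) by simp
  qed
  finally show ?thesis unfolding K_def[symmetric] using summable integrable by blast
qed

end
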